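(* Let $n\ge 1$ and let $\mathcal{L}$ denote Green's $\mathcal{L}$-relation on the multiplicative semigroup $(A^+(B_n),\circ)$. For $f,g\in A^+(B_n)$, $f\,\mathcal{L}\,g$ if and only if $\mathrm{Im}(f)=\mathrm{Im}(g)$. Moreover, for $n\ge 2$, the number of $\mathcal{L}$-classes in $(A^+(B_n),\circ)$ is $2n^2+n+1$.
   Context: For $n\ge 1$ let $[n]=\{1,\dots,n\}$. The Brandt semigroup $(B_n,+)$ has underlying set $B_n=([n]\times[n])\cup\{\vartheta\}$ with $(i,j)+(k,l)=(i,l)$ if $j=k$, $(i,j)+(k,l)=\vartheta$ if $j\ne k$, and $\alpha+\vartheta=\vartheta+\alpha=\vartheta$ for all $\alpha\in B_n$. $M(B_n)$ is the set of all maps $B_n\to B_n$; arguments are written on the left of functions. It carries pointwise addition $\alpha(f+g)=\alpha f+\alpha g$ and composition $\alpha(f\circ g)=(\alpha f)g$ (so in $f\circ g$ the map $f$ is applied first; Green's relations are taken with respect to this product). An affine map over $B_n$ is a map of the form $g+h$ with $g$ an endomorphism of the semigroup $(B_n,+)$ (not required to fix $\vartheta$) and $h\in M(B_n)$ a constant map. $A^+(B_n)$ (the affine near-semiring over $B_n$) is the smallest subset of $M(B_n)$ that contains all affine maps and is closed under $+$ and $\circ$. $\mathrm{Im}(f)$ is the full image $\{\alpha f:\alpha\in B_n\}$. *)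

theory Defs
  imports Complex_Main "HOL-Library.FuncSet"
begin

datatype brandt = Theta | Elt nat nat

definition brandt_set :: "nat \<Rightarrow> brandt set" where
  "brandt_set n = {Elt i j | i j. i \<in> {1..n} \<and> j \<in> {1..n}} \<union> {Theta}"

fun brandt_add :: "brandt \<Rightarrow> brandt \<Rightarrow> brandt" (infixl "\<oplus>\<^sub>B" 65) where
  "Elt i j \<oplus>\<^sub>B Elt k l = (if j = k then Elt i l else Theta)"
| "Theta \<oplus>\<^sub>B \<beta> = Theta"
| "\<alpha> \<oplus>\<^sub>B Theta = Theta"

text \<open>A map from the Brandt semigroup to itself is represented by a function that is
  \<open>undefined\<close> off the carrier, so that equality of maps is equality of functions.\<close>

definition brandt_maps :: "nat \<Rightarrow> (brandt \<Rightarrow> brandt) set" where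
  "brandt_maps n = brandt_set n \<rightarrow>\<^sub>E brandt_set n"

definition map_add :: "nat \<Rightarrow> (brandt \<Rightarrow> brandt) \<Rightarrow> (brandt \<Rightarrow> brandt) \<Rightarrow> brandt \<Rightarrow> brandt" where
  "map_add n f g = (\<lambda>\<alpha>\<in>brandt_set n. f \<alpha> \<oplus>\<^sub>B g \<alpha>)"

text \<open>Arguments are written on the left in this setting: in the product of \<open>f\<close> and \<open>g\<close>
  the map \<open>f\<close> is applied first, the opposite of \<^const>\<open>comp\<close> and \<^const>\<open>compose\<close>.\<close>

definition map_mult :: "nat \<Rightarrow> (brandt \<Rightarrow> brandt) \<Rightarrow> (brandt \<Rightarrow> brandt) \<Rightarrow> brandt \<Rightarrow> brandt" where
  "map_mult n f g = compose (brandt_set n) g f"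

definition endos :: "nat \<Rightarrow> (brandt \<Rightarrow> brandt) set" where
  "endos n = {g \<in> brandt_maps n. \<forall>\<alpha>\<in>brandt_set n. \<forall>\<beta>\<in>brandt_set n. g (\<alpha> \<oplus>\<^sub>B \<beta>) = g \<alpha> \<oplus>\<^sub>B g \<beta>}"

definition const_maps :: "nat \<Rightarrow> (brandt \<Rightarrow> brandt) set" where
  "const_maps n = {(\<lambda>\<alpha>\<in>brandt_set n. c) | c. c \<in> brandt_set n}"

definition affine_maps :: "nat \<Rightarrow> (brandt \<Rightarrow> brandt) set" where
  "affine_maps n = {map_add n g h | g h. g \<in> endos n \<and> h \<in> const_maps n}"

inductive_set affine_near_semiring :: "nat \<Rightarrow> (brandt \<Rightarrow> brandt) set" for n :: nat where
  affine: "f \<in> affine_maps n \<Longrightarrow> f \<in> affine_near_semiring n"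
| add: "f \<in> affine_near_semiring n \<Longrightarrow> g \<in> affine_near_semiring n
    \<Longrightarrow> map_add n f g \<in> affine_near_semiring n"
| mult: "f \<in> affine_near_semiring n \<Longrightarrow> g \<in> affine_near_semiring n
    \<Longrightarrow> map_mult n f g \<in> affine_near_semiring n"

text \<open>Green's \<open>L\<close>-relation on a semigroup with carrier \<open>S\<close> and product \<open>m\<close>: the principal
  left ideals \<open>S\<^sup>1 a\<close> and \<open>S\<^sup>1 b\<close> coincide. As \<open>S\<^sup>1\<close> is \<open>S\<close> with an identity
  adjoined if necessary, \<open>S\<^sup>1 a\<close> is \<open>S a\<close> together with \<open>a\<close>.\<close>

definition left_ideal :: "'a set \<Rightarrow> ('a \<Rightarrow> 'a \<Rightarrow> 'a) \<Rightarrow> 'a \<Rightarrow> 'a set" where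
  "left_ideal S m a = insert a {m s a | s. s \<in> S}"

definition green_L :: "'a set \<Rightarrow> ('a \<Rightarrow> 'a \<Rightarrow> 'a) \<Rightarrow> ('a \<times> 'a) set" where
  "green_L S m = {(a, b). a \<in> S \<and> b \<in> S \<and> left_ideal S m a = left_ideal S m b}"

lemma equiv_green_L: "equiv S (green_L S m)"
  by (rule equivI) (auto simp: green_L_def refl_on_def sym_def trans_def)

lemma brandt_add_closed:
  "\<alpha> \<in> brandt_set n \<Longrightarrow> \<beta> \<in> brandt_set n \<Longrightarrow> \<alpha> \<oplus>\<^sub>B \<beta> \<in> brandt_set n"
  by (cases \<alpha>; cases \<beta>) (auto simp: brandt_set_def)

lemma brandt_add_assoc: "(\<alpha> \<oplus>\<^sub>B \<beta>) \<oplus>\<^sub>B \<gamma> = \<alpha> \<oplus>\<^sub>B (\<beta> \<oplus>\<^sub>B \<gamma>)"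
  by (cases \<alpha>; cases \<beta>; cases \<gamma>) auto

lemma map_add_closed: "f \<in> brandt_maps n \<Longrightarrow> g \<in> brandt_maps n \<Longrightarrow> map_add n f g \<in> brandt_maps n"
  by (auto simp: brandt_maps_def map_add_def intro!: brandt_add_closed)

lemma map_mult_closed: "f \<in> brandt_maps n \<Longrightarrow> g \<in> brandt_maps n \<Longrightarrow> map_mult n f g \<in> brandt_maps n"
  by (auto simp: brandt_maps_def map_mult_def compose_def)

lemma affine_near_semiring_subset: "affine_near_semiring n \<subseteq> brandt_maps n"
proof
  fix f assume "f \<in> affine_near_semiring n"
  then show "f \<in> brandt_maps n"
  proof induction
    case (affine f)
    then obtain g h where "f = map_add n g h" "g \<in> endos n" "h \<in> const_maps n"
      by (auto simp: affine_maps_def)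
    moreover have "const_maps n \<subseteq> brandt_maps n" by (auto simp: const_maps_def brandt_maps_def)
    ultimately show ?case by (auto simp: endos_def intro: map_add_closed)
  qed (auto intro: map_add_closed map_mult_closed)
qed

end

theory Submission
  imports Defs "HOL-Combinatorics.Permutations"
begin

text \<open>
  Apart from the constant endomorphisms, the endomorphisms of \<open>B\<^sub>n\<close> are the automorphisms
  induced by permutations of \<open>[n]\<close>. Hence \<open>A\<^sup>+(B\<^sub>n)\<close> consists of three kinds of maps: constant maps,
  maps that are \<open>\<vartheta>\<close> except at one nonzero point, and maps supported on one column
  \<open>{(i, k) | i \<in> [n]}\<close>, where \<open>(i, k)\<close> goes to \<open>(i\<sigma>, q)\<close> for a permutation \<open>\<sigma>\<close>. If
  \<open>Im(f) = Im(g)\<close>, a left multiplier taking \<open>g\<close> to \<open>f\<close> can be chosen of the same kind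
  as \<open>f\<close>. The images are \<open>{c}\<close>, \<open>{b, \<vartheta>}\<close> with \<open>b \<noteq> \<vartheta>\<close>, and \<open>([n] \<times> {q}) \<union> {\<vartheta>}\<close>, which gives
  \<open>(n\<^sup>2 + 1) + n\<^sup>2 + n\<close> classes when \<open>n \<ge> 2\<close>.
\<close>

section \<open>Arithmetic in the Brandt semigroup\<close>

lemma brandt_set_simps [simp]:
  "Theta \<in> brandt_set n"
  "Elt i j \<in> brandt_set n \<longleftrightarrow> i \<in> {1..n} \<and> j \<in> {1..n}"
  by (auto simp: brandt_set_def)

lemma brandt_add_Theta_right [simp]: "\<alpha> \<oplus>\<^sub>B Theta = Theta"
  by (cases \<alpha>) auto

lemma brandt_idempotent:
  "\<beta> \<oplus>\<^sub>B \<beta> = \<beta> \<Longrightarrow> \<beta> \<noteq> Theta \<Longrightarrow> \<exists>s. \<beta> = Elt s s"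
  by (induction \<beta>) (auto split: if_split_asm)

text \<open>The left unit pins the first coordinate of \<open>\<beta>\<close>, the right unit the
  second. This later recovers an endomorphism from its values on the idempotents
  \<open>Elt i i\<close>.\<close>

lemma brandt_add_units_eq:
  "Elt a a \<oplus>\<^sub>B \<beta> = \<beta> \<Longrightarrow> \<beta> \<oplus>\<^sub>B Elt b b = \<beta> \<Longrightarrow> \<beta> \<noteq> Theta \<Longrightarrow> \<beta> = Elt a b"
  by (induction \<beta>) (auto split: if_split_asm)

section \<open>The three kinds of maps, and the maps induced by permutations\<close>

definition const_map :: "nat \<Rightarrow> brandt \<Rightarrow> brandt \<Rightarrow> brandt" where
  "const_map n c = (\<lambda>\<alpha>\<in>brandt_set n. c)"

definition point_map :: "nat \<Rightarrow> brandt \<Rightarrow> brandt \<Rightarrow> brandt \<Rightarrow> brandt" where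
  "point_map n x b = (\<lambda>\<alpha>\<in>brandt_set n. if \<alpha> = x then b else Theta)"

definition column_map :: "nat \<Rightarrow> nat \<Rightarrow> nat \<Rightarrow> (nat \<Rightarrow> nat) \<Rightarrow> brandt \<Rightarrow> brandt" where
  "column_map n k q \<sigma> = (\<lambda>\<alpha>\<in>brandt_set n.
     case \<alpha> of Theta \<Rightarrow> Theta | Elt i j \<Rightarrow> if j = k then Elt (\<sigma> i) q else Theta)"

definition perm_map :: "nat \<Rightarrow> (nat \<Rightarrow> nat) \<Rightarrow> brandt \<Rightarrow> brandt" where
  "perm_map n \<sigma> = (\<lambda>\<alpha>\<in>brandt_set n. case \<alpha> of Theta \<Rightarrow> Theta | Elt i j \<Rightarrow> Elt (\<sigma> i) (\<sigma> j))"

text \<open>The value \<open>b = \<vartheta>\<close> is allowed in the second clause, so that it overlaps with the first one: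
  sums and products of point maps are then point maps without exception.\<close>

inductive_set normal_maps :: "nat \<Rightarrow> (brandt \<Rightarrow> brandt) set" for n :: nat where
  const: "c \<in> brandt_set n \<Longrightarrow> const_map n c \<in> normal_maps n"
| point: "x \<in> brandt_set n \<Longrightarrow> x \<noteq> Theta \<Longrightarrow> b \<in> brandt_set n \<Longrightarrow> point_map n x b \<in> normal_maps n"
| column: "k \<in> {1..n} \<Longrightarrow> q \<in> {1..n} \<Longrightarrow> \<sigma> permutes {1..n} \<Longrightarrow> column_map n k q \<sigma> \<in> normal_maps n"

lemma permutes_atLeastAtMost_bounds:
  assumes "\<sigma> permutes {1..n}" "Suc 0 \<le> i" "i \<le> n"
  shows "Suc 0 \<le> \<sigma> i" "\<sigma> i \<le> n"
  using permutes_in_image[OF assms(1), of i] assms(2,3) by auto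

lemma normal_maps_subset: "normal_maps n \<subseteq> brandt_maps n"
proof
  fix f assume "f \<in> normal_maps n"
  then show "f \<in> brandt_maps n"
    by cases (auto simp: brandt_maps_def const_map_def point_map_def column_map_def
        permutes_atLeastAtMost_bounds split: brandt.split)
qed

lemma brandt_maps_mem: "f \<in> brandt_maps n \<Longrightarrow> \<alpha> \<in> brandt_set n \<Longrightarrow> f \<alpha> \<in> brandt_set n"
  by (auto simp: brandt_maps_def)

lemma brandt_maps_eqI:
  assumes "f \<in> brandt_maps n" "g \<in> brandt_maps n" "\<And>\<alpha>. \<alpha> \<in> brandt_set n \<Longrightarrow> f \<alpha> = g \<alpha>"
  shows "f = g"
  using assms unfolding brandt_maps_def by (metis PiE_ext)

text \<open>Products are cut off outside the carrier, so \<open>f\<close> has to stay inside it for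
  \<open>map_mult n g h\<close> to be evaluated at proper arguments.\<close>

lemma map_mult_assoc:
  assumes "f \<in> brandt_maps n"
  shows "map_mult n (map_mult n f g) h = map_mult n f (map_mult n g h)"
  using assms by (auto simp: map_mult_def compose_def brandt_maps_mem fun_eq_iff)

section \<open>Endomorphisms of the Brandt semigroup\<close>

lemma perm_map_in_endos:
  assumes "\<sigma> permutes {1..n}"
  shows "perm_map n \<sigma> \<in> endos n"
proof -
  \<comment> \<open>Injectivity makes \<open>\<sigma> j = \<sigma> k\<close> equivalent to
    \<open>j = k\<close>, so a sum equal to \<open>Theta\<close> stays \<open>Theta\<close>.\<close>
  have "inj \<sigma>" using assms by (rule permutes_inj)
  moreover have "perm_map n \<sigma> \<in> brandt_maps n"
    using assms
    by (auto simp: brandt_maps_def perm_map_def permutes_atLeastAtMost_bounds split: brandt.split)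
  moreover have "perm_map n \<sigma> (\<alpha> \<oplus>\<^sub>B \<beta>) = perm_map n \<sigma> \<alpha> \<oplus>\<^sub>B perm_map n \<sigma> \<beta>"
    if "\<alpha> \<in> brandt_set n" "\<beta> \<in> brandt_set n" for \<alpha> \<beta>
    using that \<open>inj \<sigma>\<close>
    by (cases \<alpha>; cases \<beta>) (auto simp: perm_map_def inj_eq)
  ultimately show ?thesis by (auto simp: endos_def)
qed

text \<open>Split on the image of \<open>Theta\<close>. If it is nonzero, it is an idempotent that
  absorbs every value of \<open>g\<close>, so \<open>g\<close> is constant. If \<open>Theta\<close>
  is fixed, then either some nonzero element also goes to \<open>Theta\<close> and drags all others
  along, or the nonzero idempotents are permuted and determine \<open>g\<close>.\<close>

lemma endos_cases:
  assumes g: "g \<in> endos n"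
  obtains (const) c where "c \<in> brandt_set n" "g = const_map n c"
    | (perm) \<sigma> where "\<sigma> permutes {1..n}" "g = perm_map n \<sigma>"
proof -
  have maps: "g \<in> brandt_maps n"
    and hom: "\<And>\<alpha> \<beta>. \<alpha> \<in> brandt_set n \<Longrightarrow> \<beta> \<in> brandt_set n \<Longrightarrow> g (\<alpha> \<oplus>\<^sub>B \<beta>) = g \<alpha> \<oplus>\<^sub>B g \<beta>"
    using g by (auto simp: endos_def)
  have constI: thesis if "c \<in> brandt_set n" "\<And>\<alpha>. \<alpha> \<in> brandt_set n \<Longrightarrow> g \<alpha> = c" for c
  proof (rule const)
    show "g = const_map n c"
      using that by (intro brandt_maps_eqI[OF maps]) (auto simp: brandt_maps_def const_map_def)
  qed fact
  show thesis
  proof (cases "g Theta")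
    case (Elt p r)
    have "g Theta \<oplus>\<^sub>B g Theta = g Theta" using hom[of Theta Theta, symmetric] by simp
    then have "p = r" using brandt_idempotent Elt by fastforce
    have "g \<alpha> = Elt p p" if "\<alpha> \<in> brandt_set n" for \<alpha>
    proof -
      have "g \<alpha> \<oplus>\<^sub>B Elt p p = Elt p p" "Elt p p \<oplus>\<^sub>B g \<alpha> = Elt p p"
        using hom[OF that, of Theta, symmetric] hom[OF _ that, of Theta, symmetric] Elt \<open>p = r\<close> by auto
      then show ?thesis by (cases "g \<alpha>") (auto split: if_splits)
    qed
    moreover have "Elt p p \<in> brandt_set n"
      using brandt_maps_mem[OF maps, of Theta] Elt \<open>p = r\<close> by simp
    ultimately show thesis by (intro constI)
  next
    case Theta
    show thesis
    proof (cases "\<exists>i j. Elt i j \<in> brandt_set n \<and> g (Elt i j) = Theta")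
      case True
      then obtain i j where ij: "Elt i j \<in> brandt_set n" "g (Elt i j) = Theta" by auto
      have "g \<alpha> = Theta" if "\<alpha> \<in> brandt_set n" for \<alpha>
      proof (cases \<alpha>)
        case (Elt k l)
        \<comment> \<open>Every \<open>(k, l) = (k, i) + (i, j) + (j, l)\<close> has the annihilated
          element as a summand.\<close>
        have "g (Elt k i \<oplus>\<^sub>B (Elt i j \<oplus>\<^sub>B Elt j l)) = g (Elt k i) \<oplus>\<^sub>B g (Elt i j \<oplus>\<^sub>B Elt j l)"
          using Elt that ij by (intro hom) auto
        also have "g (Elt i j \<oplus>\<^sub>B Elt j l) = Theta"
          using Elt that ij hom[of "Elt i j" "Elt j l"] by simp
        finally show ?thesis using Elt by simp
      qed (use Theta in simp)
      then show thesis by (intro constI) auto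
    next
      case False
      then have nz: "g (Elt i j) \<noteq> Theta" if "i \<in> {1..n}" "j \<in> {1..n}" for i j
        using that by auto
      have "\<exists>s. g (Elt i i) = Elt s s" if "i \<in> {1..n}" for i
      proof -
        have "g (Elt i i) \<oplus>\<^sub>B g (Elt i i) = g (Elt i i)"
          using hom[of "Elt i i" "Elt i i", symmetric] that by simp
        then show ?thesis using nz[OF that that] by (rule brandt_idempotent)
      qed
      then obtain s where s: "\<And>i. i \<in> {1..n} \<Longrightarrow> g (Elt i i) = Elt (s i) (s i)" by metis
      have gs: "g (Elt i j) = Elt (s i) (s j)" if "i \<in> {1..n}" "j \<in> {1..n}" for i j
      proof -
        have "Elt (s i) (s i) \<oplus>\<^sub>B g (Elt i j) = g (Elt i j)"
          "g (Elt i j) \<oplus>\<^sub>B Elt (s j) (s j) = g (Elt i j)"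
          using hom[of "Elt i i" "Elt i j", symmetric] hom[of "Elt i j" "Elt j j", symmetric]
            s[of i] s[of j] that by simp_all
        then show ?thesis using nz[OF that] by (rule brandt_add_units_eq)
      qed
      \<comment> \<open>A permutation of \<open>{1..n}\<close> must be the identity outside it,
        where nothing is known about \<open>s\<close>.\<close>
      define \<sigma> where "\<sigma> = (\<lambda>i. if i \<in> {1..n} then s i else i)"
      \<comment> \<open>Distinct idempotents sum to \<open>Theta\<close>. If
        \<open>s i = s j\<close>, their images would have a nonzero sum, although \<open>g\<close>
        fixes \<open>Theta\<close>.\<close>
      have "inj_on s {1..n}"
      proof (rule inj_onI, rule ccontr)
        fix i j assume ij: "i \<in> {1..n}" "j \<in> {1..n}" "s i = s j" "i \<noteq> j"
        then have "g (Elt i i \<oplus>\<^sub>B Elt j j) = Elt (s i) (s j)" using s by (subst hom) auto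
        then show False using ij Theta by simp
      qed
      moreover have "s ` {1..n} \<subseteq> {1..n}"
      proof (rule image_subsetI)
        fix i assume "i \<in> {1..n}"
        then show "s i \<in> {1..n}" using brandt_maps_mem[OF maps, of "Elt i i"] s[of i] by simp
      qed
      ultimately have "bij_betw s {1..n} {1..n}"
        by (simp add: bij_betw_def endo_inj_surj)
      then have "bij_betw \<sigma> {1..n} {1..n}"
        by (rule bij_betw_cong[THEN iffD1, rotated]) (simp add: \<sigma>_def)
      then have perm: "\<sigma> permutes {1..n}"
        by (rule bij_imp_permutes) (auto simp: \<sigma>_def)
      have "g = perm_map n \<sigma>"
      proof (rule brandt_maps_eqI[OF maps])
        show "perm_map n \<sigma> \<in> brandt_maps n" using perm_map_in_endos[OF perm] by (simp add: endos_def)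
        show "g \<alpha> = perm_map n \<sigma> \<alpha>" if "\<alpha> \<in> brandt_set n" for \<alpha>
          using that Theta gs by (cases \<alpha>) (auto simp: perm_map_def \<sigma>_def)
      qed
      with perm show thesis by (rule that(2))
    qed
  qed
qed

section \<open>Sums and products of the three kinds of maps\<close>

lemma map_add_const_const: "map_add n (const_map n a) (const_map n b) = const_map n (a \<oplus>\<^sub>B b)"
  by (auto simp: map_add_def const_map_def fun_eq_iff)

lemma map_add_point_right:
  "x \<in> brandt_set n \<Longrightarrow> map_add n f (point_map n x b) = point_map n x (f x \<oplus>\<^sub>B b)"
  by (auto simp: map_add_def point_map_def fun_eq_iff)

lemma map_add_point_left:
  "x \<in> brandt_set n \<Longrightarrow> map_add n (point_map n x b) f = point_map n x (b \<oplus>\<^sub>B f x)"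
  by (auto simp: map_add_def point_map_def fun_eq_iff)

text \<open>At \<open>(i, j)\<close> the sum survives only if \<open>\<sigma> j = p\<close>, which
  selects one column. This is how column maps arise from affine maps.\<close>

lemma map_add_perm_const:
  assumes "\<sigma> permutes {1..n}"
  shows "map_add n (perm_map n \<sigma>) (const_map n (Elt p q)) = column_map n (inv \<sigma> p) q \<sigma>"
  by (auto simp: permutes_inverses[OF assms]
      map_add_def perm_map_def const_map_def column_map_def fun_eq_iff
      split: brandt.split)

lemma map_add_Theta_const: "map_add n f (const_map n Theta) = const_map n Theta"
  "map_add n (const_map n Theta) f = const_map n Theta"
  by (auto simp: map_add_def const_map_def fun_eq_iff)

lemma map_add_column_const:
  "map_add n (column_map n k q \<sigma>) (const_map n (Elt p r))
     = (if q = p then column_map n k r \<sigma> else const_map n Theta)"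
  by (auto simp: map_add_def column_map_def const_map_def fun_eq_iff split: brandt.split)

text \<open>Adding on the left tests the first coordinate \<open>\<sigma> i\<close> against
  \<open>r\<close>, so the column shrinks to a single point.\<close>

lemma map_add_const_column:
  assumes "\<sigma> permutes {1..n}"
  shows "map_add n (const_map n (Elt p r)) (column_map n k q \<sigma>)
     = point_map n (Elt (inv \<sigma> r) k) (Elt p q)"
  by (auto simp: permutes_inverses[OF assms]
      map_add_def column_map_def const_map_def point_map_def fun_eq_iff
      split: brandt.split)

text \<open>Different columns are disjoint supports. In a common column the sum survives only in the
  row with \<open>\<tau> i = q\<close>.\<close>

lemma map_add_column_column:
  assumes "\<tau> permutes {1..n}"
  shows "map_add n (column_map n k q \<sigma>) (column_map n l r \<tau>)
     = (if k = l then point_map n (Elt (inv \<tau> q) k) (Elt (\<sigma> (inv \<tau> q)) r) else const_map n Theta)"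
  by (auto simp: permutes_inverses[OF assms]
      map_add_def column_map_def const_map_def point_map_def fun_eq_iff
      split: brandt.split)

lemma map_mult_const_left: "c \<in> brandt_set n \<Longrightarrow> map_mult n (const_map n c) f = const_map n (f c)"
  by (auto simp: map_mult_def compose_def const_map_def fun_eq_iff)

lemma map_mult_const_right:
  "f \<in> brandt_maps n \<Longrightarrow> map_mult n f (const_map n c) = const_map n c"
  by (auto simp: map_mult_def compose_def const_map_def brandt_maps_mem fun_eq_iff)

text \<open>Off \<open>x\<close> the left factor yields \<open>Theta\<close>, which \<open>f\<close>
  must fix for the product to be supported at \<open>x\<close> again.\<close>

lemma map_mult_point_left:
  "f Theta = Theta \<Longrightarrow> map_mult n (point_map n x b) f = point_map n x (f b)"
  by (auto simp: map_mult_def compose_def point_map_def fun_eq_iff)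

lemma map_mult_column_point:
  assumes "\<sigma> permutes {1..n}" "q \<in> {1..n}"
  shows "map_mult n (column_map n k q \<sigma>) (point_map n (Elt i j) b)
     = (if q = j then point_map n (Elt (inv \<sigma> i) k) b else const_map n Theta)"
  using assms permutes_atLeastAtMost_bounds[OF assms(1)]
  by (auto simp: permutes_inverses[OF assms(1)]
      map_mult_def compose_def column_map_def const_map_def point_map_def fun_eq_iff
      split: brandt.split)

text \<open>All nonzero values of the left factor lie in column \<open>q\<close>, so they reach the
  support of the right factor only if \<open>q = l\<close>. The left factor acts first, whence the
  order in \<open>\<tau> \<circ> \<sigma>\<close>.\<close>

lemma map_mult_column_column:
  assumes "\<sigma> permutes {1..n}" "q \<in> {1..n}"
  shows "map_mult n (column_map n k q \<sigma>) (column_map n l r \<tau>)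
     = (if q = l then column_map n k r (\<tau> \<circ> \<sigma>) else const_map n Theta)"
  using assms permutes_atLeastAtMost_bounds[OF assms(1)]
  by (auto simp: map_mult_def compose_def column_map_def const_map_def fun_eq_iff
      split: brandt.split)

lemma map_add_normal_maps:
  assumes "f \<in> normal_maps n" "g \<in> normal_maps n"
  shows "map_add n f g \<in> normal_maps n"
proof -
  have mem: "f \<alpha> \<in> brandt_set n" "g \<alpha> \<in> brandt_set n" if "\<alpha> \<in> brandt_set n" for \<alpha>
    using assms that normal_maps_subset brandt_maps_mem by blast+
  have Theta_normal: "const_map n Theta \<in> normal_maps n" by (intro normal_maps.const) simp
  show ?thesis
    using assms(1)
  proof cases
    case f: (const a)
    show ?thesis using assms(2)
    proof cases
      case (const b)
      with f show ?thesis by (auto simp: map_add_const_const intro: normal_maps.const brandt_add_closed)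
    next
      case (point x b)
      show ?thesis
        unfolding point(1) map_add_point_right[OF point(2)]
        by (intro normal_maps.point brandt_add_closed mem point)
    next
      case (column k q \<sigma>)
      show ?thesis
      proof (cases a)
        case Theta
        show ?thesis unfolding f(1) Theta map_add_Theta_const by (rule Theta_normal)
      next
        case (Elt p r)
        show ?thesis
          unfolding f(1) column(1) Elt map_add_const_column[OF column(4)]
          using f(2) column(2,3) Elt permutes_in_image[OF permutes_inv[OF column(4)], of r]
          by (intro normal_maps.point) auto
      qed
    qed
  next
    case (point x b)
    show ?thesis
      unfolding point(1) map_add_point_left[OF point(2)]
      by (intro normal_maps.point brandt_add_closed mem point)
  next
    case f: (column k q \<sigma>)
    show ?thesis using assms(2)
    proof cases
      case (const b)
      then show ?thesis
        using f Theta_normal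
        by (cases b) (auto simp: map_add_Theta_const map_add_column_const intro!: normal_maps.column)
    next
      case (point x b)
      show ?thesis
        unfolding point(1) map_add_point_right[OF point(2)]
        by (intro normal_maps.point brandt_add_closed mem point)
    next
      case (column l r \<tau>)
      then have "inv \<tau> q \<in> {1..n}"
        using f(3) permutes_in_image[OF permutes_inv[OF column(4)], of q] by simp
      moreover from this have "\<sigma> (inv \<tau> q) \<in> {1..n}"
        using permutes_in_image[OF f(4)] by blast
      ultimately show ?thesis
        unfolding f(1) column(1) map_add_column_column[OF column(4)]
        using f(2) column(3) Theta_normal by (auto intro: normal_maps.point)
    qed
  qed
qed

text \<open>Point and column maps always fix \<open>Theta\<close>, and a constant map attaining
  \<open>Theta\<close> has no other value. It allows \<open>map_mult_point_left\<close> to be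
  applied when only the image of the right factor is known.\<close>

lemma normal_maps_Theta:
  assumes "f \<in> normal_maps n" "Theta \<in> f ` brandt_set n"
  shows "f Theta = Theta"
  using assms(1) by cases (use assms(2) in \<open>auto simp: const_map_def point_map_def column_map_def\<close>)

lemma map_mult_normal_maps:
  assumes "f \<in> normal_maps n" "g \<in> normal_maps n"
  shows "map_mult n f g \<in> normal_maps n"
proof -
  have mem: "g \<alpha> \<in> brandt_set n" if "\<alpha> \<in> brandt_set n" for \<alpha>
    using assms that normal_maps_subset brandt_maps_mem by blast
  have maps: "f \<in> brandt_maps n" using assms normal_maps_subset by blast
  have Theta_normal: "const_map n Theta \<in> normal_maps n" by (intro normal_maps.const) simp
  show ?thesis
    using assms(2)
  proof cases
    case (const c)
    then show ?thesis using maps by (auto simp: map_mult_const_right intro: normal_maps.const)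
  next
    case g: (point y d)
    then obtain i j where y: "y = Elt i j" by (cases y) auto
    have "g Theta = Theta" using g by (auto simp: point_map_def)
    from assms(1) show ?thesis
    proof cases
      case (column k q \<sigma>)
      have "inv \<sigma> i \<in> {1..n}"
        using g(2) y permutes_in_image[OF permutes_inv[OF column(4)], of i] by simp
      then show ?thesis
        unfolding g(1) y column(1) map_mult_column_point[OF column(4,3)]
        using g(4) column(2) Theta_normal by (auto intro: normal_maps.point)
    next
      case (const c)
      show ?thesis
        unfolding const(1) map_mult_const_left[OF const(2)] by (intro normal_maps.const mem const)
    next
      case (point x b)
      show ?thesis
        unfolding point(1) map_mult_point_left[of g, OF \<open>g Theta = Theta\<close>]
        by (intro normal_maps.point mem point)
    qed
  next
    case g: (column l r \<tau>)
    have "g Theta = Theta" using g by (auto simp: column_map_def)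
    from assms(1) show ?thesis
    proof cases
      case (column k q \<sigma>)
      show ?thesis
        unfolding g(1) column(1) map_mult_column_column[OF column(4,3)]
        using normal_maps.column[OF column(2) g(3) permutes_compose[OF column(4) g(4)]] Theta_normal
        by simp
    next
      case (const c)
      show ?thesis
        unfolding const(1) map_mult_const_left[OF const(2)] by (intro normal_maps.const mem const)
    next
      case (point x b)
      show ?thesis
        unfolding point(1) map_mult_point_left[of g, OF \<open>g Theta = Theta\<close>]
        by (intro normal_maps.point mem point)
    qed
  qed
qed

section \<open>Identification of the affine near-semiring with the three kinds of maps\<close>

lemma affine_maps_subset_normal_maps: "affine_maps n \<subseteq> normal_maps n"
proof
  fix f assume "f \<in> affine_maps n"
  then obtain g c where f: "f = map_add n g (const_map n c)"
    and g: "g \<in> endos n" and c: "c \<in> brandt_set n"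
    by (auto simp: affine_maps_def const_maps_def const_map_def)
  from g show "f \<in> normal_maps n"
  proof (cases rule: endos_cases)
    case (const d)
    with f c show ?thesis by (auto intro: map_add_normal_maps normal_maps.const)
  next
    case (perm \<sigma>)
    show ?thesis
    proof (cases c)
      case Theta
      show ?thesis unfolding f Theta map_add_Theta_const by (rule normal_maps.const) simp
    next
      case (Elt p q)
      show ?thesis
        unfolding f perm(2) Elt map_add_perm_const[OF perm(1)]
        using c Elt perm(1) permutes_in_image[OF permutes_inv[OF perm(1)], of p]
        by (intro normal_maps.column) auto
    qed
  qed
qed

lemma const_map_affine:
  assumes "c \<in> brandt_set n"
  shows "const_map n c \<in> affine_near_semiring n"
proof -
  \<comment> \<open>A constant map is an endomorphism if its value is idempotent; \<open>e\<close>
    is an idempotent acting as a left unit on \<open>c\<close>.\<close>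
  define e where "e = (case c of Theta \<Rightarrow> Theta | Elt p q \<Rightarrow> Elt p p)"
  have e: "e \<in> brandt_set n" "e \<oplus>\<^sub>B e = e" "e \<oplus>\<^sub>B c = c"
    using assms by (auto simp: e_def split: brandt.split)
  then have "const_map n e \<in> endos n"
    by (auto simp: endos_def brandt_maps_def const_map_def brandt_add_closed)
  moreover have "const_map n c = map_add n (const_map n e) (const_map n c)"
    using e by (simp add: map_add_const_const)
  moreover have "const_map n c \<in> const_maps n"
    using assms by (auto simp: const_maps_def const_map_def)
  ultimately show ?thesis
    unfolding affine_maps_def by (intro affine_near_semiring.affine[unfolded affine_maps_def]) blast
qed

lemma column_map_affine:
  assumes "k \<in> {1..n}" "q \<in> {1..n}" "\<sigma> permutes {1..n}"
  shows "column_map n k q \<sigma> \<in> affine_near_semiring n"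
proof (rule affine_near_semiring.affine)
  \<comment> \<open>The first coordinate \<open>\<sigma> k\<close> is chosen so that the surviving
    column is \<open>inv \<sigma> (\<sigma> k) = k\<close>.\<close>
  have "column_map n k q \<sigma> = map_add n (perm_map n \<sigma>) (const_map n (Elt (\<sigma> k) q))"
    using assms by (simp add: map_add_perm_const permutes_inverses)
  moreover have "const_map n (Elt (\<sigma> k) q) \<in> const_maps n"
    using assms permutes_in_image[OF assms(3), of k] by (auto simp: const_maps_def const_map_def)
  ultimately show "column_map n k q \<sigma> \<in> affine_maps n"
    using perm_map_in_endos[OF assms(3)] by (auto simp: affine_maps_def)
qed

lemma affine_near_semiring_eq: "affine_near_semiring n = normal_maps n"
proof
  show "affine_near_semiring n \<subseteq> normal_maps n"
  proof
    fix f assume "f \<in> affine_near_semiring n"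
    then show "f \<in> normal_maps n"
      by induction
        (use affine_maps_subset_normal_maps map_add_normal_maps map_mult_normal_maps in auto)
  qed
  show "normal_maps n \<subseteq> affine_near_semiring n"
  proof
    fix f assume "f \<in> normal_maps n"
    then show "f \<in> affine_near_semiring n"
    proof cases
      case (const c)
      then show ?thesis by (simp add: const_map_affine)
    next
      case (column k q \<sigma>)
      then show ?thesis by (simp add: column_map_affine)
    next
      case (point x b)
      then obtain i k where x: "x = Elt i k" by (cases x) auto
      show ?thesis
      proof (cases b)
        case Theta
        then have "f = const_map n Theta"
          using point by (auto simp: point_map_def const_map_def)
        then show ?thesis by (simp add: const_map_affine)
      next
        case (Elt p q)
        \<comment> \<open>On column \<open>k\<close> the sum is \<open>(p, i) + (i', q)\<close>,
          which is nonzero only in row \<open>i' = i\<close>, where it equals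
          \<open>(p, q)\<close>.\<close>
        have "f = map_add n (const_map n (Elt p i)) (column_map n k q id)"
          using point x Elt by (simp add: map_add_const_column[OF permutes_id])
        then show ?thesis
          using point x Elt permutes_id
          by (auto intro!: affine_near_semiring.add const_map_affine column_map_affine)
      qed
    qed
  qed
qed

section \<open>Images and Green's relation\<close>

lemma image_const_map: "const_map n c ` brandt_set n = {c}"
proof -
  have "brandt_set n \<noteq> {}" using brandt_set_simps(1) by blast
  then show ?thesis by (auto simp: const_map_def)
qed

lemma image_point_map:
  assumes "x \<in> brandt_set n" "x \<noteq> Theta"
  shows "point_map n x b ` brandt_set n = {b, Theta}"
proof
  show "point_map n x b ` brandt_set n \<subseteq> {b, Theta}" by (auto simp: point_map_def)
  have "b = point_map n x b x" "Theta = point_map n x b Theta"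
    using assms by (auto simp: point_map_def)
  then show "{b, Theta} \<subseteq> point_map n x b ` brandt_set n"
    using assms(1) by (metis brandt_set_simps(1) empty_subsetI imageI insert_subset)
qed

lemma image_column_map:
  assumes "k \<in> {1..n}" "\<sigma> permutes {1..n}"
  shows "column_map n k q \<sigma> ` brandt_set n = insert Theta ((\<lambda>i. Elt i q) ` {1..n})"
proof (intro equalityI subsetI)
  fix \<beta> assume "\<beta> \<in> column_map n k q \<sigma> ` brandt_set n"
  then show "\<beta> \<in> insert Theta ((\<lambda>i. Elt i q) ` {1..n})"
    using permutes_atLeastAtMost_bounds[OF assms(2)]
    by (auto simp: column_map_def split: brandt.splits if_splits)
next
  fix \<beta> assume "\<beta> \<in> insert Theta ((\<lambda>i. Elt i q) ` {1..n})"
  then consider "\<beta> = Theta" | i where "\<beta> = Elt i q" "i \<in> {1..n}" by auto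
  then show "\<beta> \<in> column_map n k q \<sigma> ` brandt_set n"
  proof cases
    case 1
    then show ?thesis by (auto simp: column_map_def intro!: image_eqI[where x = Theta])
  next
    case 2
    then show ?thesis
      using assms permutes_atLeastAtMost_bounds[OF permutes_inv[OF assms(2)]]
      by (auto simp: column_map_def permutes_inverses intro!: image_eqI[where x = "Elt (inv \<sigma> i) k"])
  qed
qed

text \<open>The multiplier sends the support of \<open>f\<close> to preimages under \<open>g\<close>
  of the values of \<open>f\<close>. One preimage suffices for a constant or a point map; for a
  column map a whole column must be matched by a permutation.\<close>

lemma normal_maps_left_multiple:
  assumes n: "n \<ge> 1" and f: "f \<in> normal_maps n" and g: "g \<in> normal_maps n"
    and im: "f ` brandt_set n = g ` brandt_set n"
  shows "\<exists>s \<in> normal_maps n. f = map_mult n s g"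
  using f
proof cases
  case (const c)
  then obtain y where y: "y \<in> brandt_set n" "c = g y"
    using im by (auto simp: image_const_map)
  then show ?thesis
    using const by (intro bexI[of _ "const_map n y"])
      (auto simp: map_mult_const_left intro: normal_maps.const)
next
  case (point x b)
  then have img: "g ` brandt_set n = {b, Theta}" using im by (simp add: image_point_map)
  then have "g Theta = Theta" by (intro normal_maps_Theta[OF g]) simp
  moreover obtain y where "y \<in> brandt_set n" "b = g y" using img by (metis image_iff insertI1)
  ultimately show ?thesis
    using point by (intro bexI[of _ "point_map n x y"])
      (auto simp: map_mult_point_left intro: normal_maps.point)
next
  case (column k q \<sigma>)
  then have img: "g ` brandt_set n = insert Theta ((\<lambda>i. Elt i q) ` {1..n})"
    using im by (simp add: image_column_map)
  have mem: "Elt i q \<in> g ` brandt_set n" if "i \<in> {1..n}" for i using that img by auto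
  from g show ?thesis
  proof cases
    case (const c)
    \<comment> \<open>Impossible: a constant map cannot attain both \<open>Theta\<close> and
      \<open>Elt 1 q\<close>.\<close>
    then show ?thesis using mem[of 1] img n by (auto simp: image_const_map)
  next
    case (column l r \<tau>)
    have "q = r"
      using mem[of 1] n column by (auto simp: image_column_map)
    \<comment> \<open>The multiplier must land in column \<open>l\<close>, the support of
      \<open>g\<close>, and its permutation \<open>\<rho>\<close> solves
      \<open>\<tau> \<circ> \<rho> = \<sigma>\<close>.\<close>
    have "f = map_mult n (column_map n k l (inv \<tau> \<circ> \<sigma>)) g"
      using column \<open>f = _\<close> \<open>\<sigma> permutes _\<close> \<open>q = r\<close>
      by (simp add: map_mult_column_column permutes_compose permutes_inv comp_assoc[symmetric]
          permutes_inv_o)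
    then show ?thesis
      using column \<open>k \<in> _\<close> \<open>\<sigma> permutes _\<close>
      by (intro bexI) (auto intro!: normal_maps.column permutes_compose permutes_inv)
  next
    case (point y b)
    \<comment> \<open>A point map has at most one nonzero value, which forces \<open>n = 1\<close>.
      Then \<open>f\<close> and \<open>g\<close> are both the identity on the two-element
      carrier.\<close>
    have "b = Elt 1 q" "b = Elt n q"
      using mem[of 1] mem[of n] n point by (auto simp: image_point_map)
    then have "n = 1" "b = Elt 1 q" by auto
    moreover have "y = Elt 1 1" using point \<open>n = 1\<close> by (cases y) auto
    moreover have "\<sigma> = id" using column \<open>n = 1\<close> by simp
    moreover have "k = 1" using column \<open>n = 1\<close> by simp
    ultimately have "f = map_mult n f g"
      using column point by (auto simp: map_mult_def compose_def column_map_def point_map_def fun_eq_iff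
          split: brandt.split)
    then show ?thesis using f by blast
  qed
qed

text \<open>By associativity \<open>t f = (t s) g\<close> is again a left multiple of
  \<open>g\<close>, and so is \<open>f\<close> itself.\<close>

lemma left_ideal_subset:
  assumes "S \<subseteq> brandt_maps n" "\<And>s t. s \<in> S \<Longrightarrow> t \<in> S \<Longrightarrow> map_mult n s t \<in> S"
    and "s \<in> S" "f = map_mult n s g"
  shows "left_ideal S (map_mult n) f \<subseteq> left_ideal S (map_mult n) g"
proof -
  have "map_mult n t f \<in> left_ideal S (map_mult n) g" if "t \<in> S" for t
  proof -
    have "map_mult n t f = map_mult n (map_mult n t s) g"
      unfolding assms(4) using assms(1) that by (intro map_mult_assoc[symmetric]) blast
    then show ?thesis using assms(2)[OF that assms(3)] unfolding left_ideal_def by blast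
  qed
  moreover have "f \<in> left_ideal S (map_mult n) g"
    using assms(3,4) unfolding left_ideal_def by blast
  ultimately show ?thesis unfolding left_ideal_def[of S _ f] by blast
qed

text \<open>The left factor acts first and only limits the arguments that reach
  \<open>g\<close>.\<close>

lemma image_map_mult_subset:
  "s \<in> brandt_maps n \<Longrightarrow> map_mult n s g ` brandt_set n \<subseteq> g ` brandt_set n"
  by (auto simp: map_mult_def compose_def brandt_maps_mem)

lemma left_ideal_image_subset:
  assumes "S \<subseteq> brandt_maps n" "f \<in> left_ideal S (map_mult n) g"
  shows "f ` brandt_set n \<subseteq> g ` brandt_set n"
  using assms image_map_mult_subset unfolding left_ideal_def by blast

text \<open>Each map lies in the left ideal of the other, so each image contains the other.
  Conversely, equal images give multipliers in both directions by
  \<open>normal_maps_left_multiple\<close>.\<close>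

lemma green_L_iff_image:
  assumes n: "n \<ge> 1" and f: "f \<in> affine_near_semiring n" and g: "g \<in> affine_near_semiring n"
  shows "(f, g) \<in> green_L (affine_near_semiring n) (map_mult n)
    \<longleftrightarrow> f ` brandt_set n = g ` brandt_set n"
proof
  assume "(f, g) \<in> green_L (affine_near_semiring n) (map_mult n)"
  then have eq: "left_ideal (affine_near_semiring n) (map_mult n) f
    = left_ideal (affine_near_semiring n) (map_mult n) g"
    by (simp add: green_L_def)
  have self: "h \<in> left_ideal (affine_near_semiring n) (map_mult n) h" for h
    unfolding left_ideal_def by (rule insertI1)
  show "f ` brandt_set n = g ` brandt_set n"
  proof (rule equalityI)
    show "f ` brandt_set n \<subseteq> g ` brandt_set n"
      using left_ideal_image_subset[OF affine_near_semiring_subset self[of f, unfolded eq]] .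
    show "g ` brandt_set n \<subseteq> f ` brandt_set n"
      using left_ideal_image_subset[OF affine_near_semiring_subset self[of g, folded eq]] .
  qed
next
  assume im: "f ` brandt_set n = g ` brandt_set n"
  have *: "left_ideal (affine_near_semiring n) (map_mult n) f
      \<subseteq> left_ideal (affine_near_semiring n) (map_mult n) g"
    if "f \<in> affine_near_semiring n" "g \<in> affine_near_semiring n"
      "f ` brandt_set n = g ` brandt_set n" for f g
  proof -
    have "\<exists>s \<in> affine_near_semiring n. f = map_mult n s g"
      using that unfolding affine_near_semiring_eq by (rule normal_maps_left_multiple[OF n])
    then obtain s where s: "s \<in> affine_near_semiring n" "f = map_mult n s g"
      by (rule bexE)
    show ?thesis
      by (rule left_ideal_subset[OF affine_near_semiring_subset affine_near_semiring.mult s])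
  qed
  have "left_ideal (affine_near_semiring n) (map_mult n) f
    = left_ideal (affine_near_semiring n) (map_mult n) g"
    using *[OF f g im] *[OF g f im[symmetric]] by (rule equalityI)
  with f g show "(f, g) \<in> green_L (affine_near_semiring n) (map_mult n)"
    by (simp add: green_L_def)
qed

section \<open>Counting the classes\<close>

lemma card_quotient_kernel:
  assumes "equiv S r" "\<And>x y. x \<in> S \<Longrightarrow> y \<in> S \<Longrightarrow> (x, y) \<in> r \<longleftrightarrow> F x = F y"
  shows "card (S // r) = card (F ` S)"
proof -
  have "r `` {x} = {y \<in> S. F y = F x}" if "x \<in> S" for x
  proof -
    have "(x, y) \<in> r \<longleftrightarrow> y \<in> S \<and> F y = F x" for y
      using equiv_type[OF assms(1)] assms(2)[OF that] by (metis mem_Sigma_iff subsetD)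
    then show ?thesis by blast
  qed
  then have "S // r = (\<lambda>z. {y \<in> S. F y = z}) ` F ` S"
    by (auto simp: quotient_def image_image)
  \<comment> \<open>A fibre over an attained value is nonempty, hence determines that value.\<close>
  moreover have "inj_on (\<lambda>z. {y \<in> S. F y = z}) (F ` S)"
    by (rule inj_onI) blast
  ultimately show ?thesis by (simp add: card_image)
qed

lemma images_normal_maps:
  assumes "n \<ge> 1"
  shows "(\<lambda>f. f ` brandt_set n) ` normal_maps n
    = (\<lambda>c. {c}) ` brandt_set n
      \<union> (\<lambda>b. {b, Theta}) ` (brandt_set n - {Theta})
      \<union> (\<lambda>q. insert Theta ((\<lambda>i. Elt i q) ` {1..n})) ` {1..n}" (is "?L = ?A \<union> ?B \<union> ?C")
proof (intro equalityI subsetI)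
  fix X assume "X \<in> ?L"
  then obtain f where f: "f \<in> normal_maps n" "X = f ` brandt_set n" by auto
  from f(1) show "X \<in> ?A \<union> ?B \<union> ?C"
  proof cases
    case (const c)
    then show ?thesis using f by (auto simp: image_const_map)
  next
    case (point x b)
    \<comment> \<open>A point map with value \<open>Theta\<close> has image \<open>{Theta}\<close>,
      which belongs to the singletons.\<close>
    then show ?thesis using f by (cases "b = Theta") (auto simp: image_point_map)
  next
    case (column k q \<sigma>)
    then show ?thesis using f by (auto simp: image_column_map)
  qed
next
  fix X assume "X \<in> ?A \<union> ?B \<union> ?C"
  then consider c where "c \<in> brandt_set n" "X = {c}"
    | b where "b \<in> brandt_set n" "X = {b, Theta}"
    | q where "q \<in> {1..n}" "X = insert Theta ((\<lambda>i. Elt i q) ` {1..n})"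
    by blast
  then show "X \<in> ?L"
  proof cases
    case 1
    then show ?thesis
      using normal_maps.const image_const_map by (metis imageI)
  next
    case 2
    have one: "Elt 1 1 \<in> brandt_set n" using assms by simp
    show ?thesis
      unfolding 2(2) image_point_map[OF one, of b, symmetric, simplified]
      by (intro imageI normal_maps.point one 2) (use one in simp_all)
  next
    case 3
    have one: "1 \<in> {1..n}" using assms by simp
    show ?thesis
      unfolding 3(2) image_column_map[OF one permutes_id, of q, symmetric]
      by (intro imageI normal_maps.column one 3 permutes_id)
  qed
qed

lemma brandt_set_nonzero: "brandt_set n - {Theta} = case_prod Elt ` ({1..n} \<times> {1..n})"
  by (auto simp: brandt_set_def)

lemma card_brandt_set_nonzero: "card (brandt_set n - {Theta}) = n ^ 2"
proof -
  have "inj_on (case_prod Elt) ({1..n} \<times> {1..n})" by (auto simp: inj_on_def)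
  then show ?thesis
    by (simp add: brandt_set_nonzero card_image card_cartesian_product power2_eq_square)
qed

lemma finite_brandt_set: "finite (brandt_set n)"
proof -
  have "brandt_set n = insert Theta (case_prod Elt ` ({1..n} \<times> {1..n}))"
    using brandt_set_nonzero[of n] by (metis brandt_set_simps(1) insert_Diff)
  then show ?thesis by simp
qed

lemma card_brandt_set: "card (brandt_set n) = n ^ 2 + 1"
  using card_Suc_Diff1[OF finite_brandt_set, of Theta n] card_brandt_set_nonzero[of n] by simp

text \<open>Members of the three families have 1, 2 and \<open>n + 1\<close> elements. For
  \<open>n \<ge> 2\<close> these sizes differ, so the families are disjoint and their cardinalities
  add up; for \<open>n = 1\<close> the last two families would coincide.\<close>

lemma card_images_normal_maps:
  assumes "n \<ge> 2"
  shows "card ((\<lambda>f. f ` brandt_set n) ` normal_maps n) = 2 * n ^ 2 + n + 1"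
proof -
  let ?A = "(\<lambda>c. {c}) ` brandt_set n"
  let ?B = "(\<lambda>b. {b, Theta}) ` (brandt_set n - {Theta})"
  let ?col = "\<lambda>q. insert Theta ((\<lambda>i. Elt i q) ` {1..n})"
  let ?C = "?col ` {1..n}"
  have "card ?A = n ^ 2 + 1"
    by (subst card_image) (auto simp: card_brandt_set)
  moreover have "card ?B = n ^ 2"
    by (subst card_image) (auto simp: card_brandt_set_nonzero inj_on_def doubleton_eq_iff)
  moreover have "inj_on ?col {1..n}"
  proof (rule inj_onI)
    fix q r assume "q \<in> {1..n}" "?col q = ?col r"
    \<comment> \<open>One nonzero element of the image already reveals the column index.\<close>
    then have "Elt 1 q \<in> ?col r"
      using assms by (metis atLeastAtMost_iff imageI insertI2 one_le_numeral order.trans order_refl)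
    then show "q = r" by auto
  qed
  then have "card ?C = n" by (simp add: card_image)
  moreover have card_A: "card X = 1" if "X \<in> ?A" for X using that by auto
  have card_B: "card X = 2" if "X \<in> ?B" for X using that by (auto simp: card_2_iff)
  have card_C: "card X = n + 1" if "X \<in> ?C" for X
  proof -
    from that obtain q where X: "X = ?col q" by auto
    have "card ((\<lambda>i. Elt i q) ` {1..n}) = n" by (subst card_image) (auto simp: inj_on_def)
    then show ?thesis unfolding X by (subst card_insert_disjoint) auto
  qed
  have disjoint: "P \<inter> Q = {}"
    if "\<And>X. X \<in> P \<Longrightarrow> card X = k" "\<And>X. X \<in> Q \<Longrightarrow> card X = l" "k \<noteq> l"
    for P Q :: "brandt set set" and k l
    using that by blast
  have "?A \<inter> ?B = {}"
    by (rule disjoint[OF card_A card_B]) simp_all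
  moreover have "(?A \<union> ?B) \<inter> ?C = {}"
    unfolding Int_Un_distrib2 Un_empty
    using assms by (intro conjI disjoint[OF card_A card_C] disjoint[OF card_B card_C]) simp_all
  moreover have "finite ?A" "finite ?B" "finite ?C" using finite_brandt_set by auto
  ultimately have "card (?A \<union> ?B \<union> ?C) = 2 * n ^ 2 + n + 1"
    by (simp add: card_Un_disjoint)
  then show ?thesis using assms by (subst images_normal_maps) auto
qed

theorem theorem4p5:
  fixes n :: nat
  assumes "n \<ge> 1"
  shows "(\<forall>f \<in> affine_near_semiring n. \<forall>g \<in> affine_near_semiring n.
            (f, g) \<in> green_L (affine_near_semiring n) (map_mult n)
              \<longleftrightarrow> f ` brandt_set n = g ` brandt_set n)
       \<and> (n \<ge> 2 \<longrightarrow>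
            card (affine_near_semiring n // green_L (affine_near_semiring n) (map_mult n))
              = 2 * n ^ 2 + n + 1)"
proof (intro conjI impI ballI)
  show "(f, g) \<in> green_L (affine_near_semiring n) (map_mult n)
      \<longleftrightarrow> f ` brandt_set n = g ` brandt_set n"
    if "f \<in> affine_near_semiring n" "g \<in> affine_near_semiring n" for f g
    using green_L_iff_image[OF assms that] .
next
  assume "n \<ge> 2"
  have "card (affine_near_semiring n // green_L (affine_near_semiring n) (map_mult n))
      = card ((\<lambda>f. f ` brandt_set n) ` affine_near_semiring n)"
    using green_L_iff_image[OF assms] by (intro card_quotient_kernel equiv_green_L)
  also have "\<dots> = 2 * n ^ 2 + n + 1"
    unfolding affine_near_semiring_eq by (rule card_images_normal_maps[OF \<open>n \<ge> 2\<close>])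
  finally show "card (affine_near_semiring n // green_L (affine_near_semiring n) (map_mult n))
      = 2 * n ^ 2 + n + 1" .
qed

end
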